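(* Let $N$ be a finite set and let $f: 2^{N} \to \mathbb{R} \cup \{-\infty\}$ be an M$^{\natural}$-concave function. Then for any $X, Y \subseteq N$ and any $I \subseteq X \setminus Y$, $$f(X) + f(Y) \leq \max_{J \subseteq Y \setminus X,\ |J| \leq |I|} \{ f((X \setminus I) \cup J) + f((Y \setminus J) \cup I) \}.$$
   Context: For $f: 2^{N} \to \mathbb{R} \cup \{-\infty\}$, the effective domain is $\mathrm{dom}\, f = \{ X \subseteq N \mid f(X) > -\infty \}$. Conventions: $(-\infty)+a = a+(-\infty) = (-\infty)+(-\infty) = -\infty$ for $a \in \mathbb{R}$, and $-\infty \leq -\infty$. A function $f: 2^{N} \to \mathbb{R} \cup \{-\infty\}$ with $\mathrm{dom}\, f \neq \emptyset$ is called M$^{\natural}$-concave if for any $X, Y \in \mathrm{dom}\, f$ and any $i \in X \setminus Y$, at least one of the following holds: (i) $X \setminus \{i\} \in \mathrm{dom}\, f$, $Y \cup \{i\} \in \mathrm{dom}\, f$, and $f(X) + f(Y) \leq f(X \setminus \{i\}) + f(Y \cup \{i\})$; (ii) there exists $j \in Y \setminus X$ such that $(X \setminus \{i\}) \cup \{j\} \in \mathrm{dom}\, f$, $(Y \cup \{i\}) \setminus \{j\} \in \mathrm{dom}\, f$, and $f(X) + f(Y) \leq f((X \setminus \{i\}) \cup \{j\}) + f((Y \cup \{i\}) \setminus \{j\})$. *)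

theory Defs
  imports Complex_Main "HOL-Library.Extended_Real"
begin

text \<open>
  Functions \<open>f : 2^N \<rightarrow> \<real> \<union> {-\<infinity>}\<close> are represented by functions into \<^typ>\<open>ereal\<close>
  that do not take the value \<open>\<infinity>\<close> on subsets of \<open>N\<close>; values outside \<open>Pow N\<close> are irrelevant.
  On these values, addition and order of \<^typ>\<open>ereal\<close> follow the usual conventions
  \<open>-\<infinity> + a = a + (-\<infinity>) = (-\<infinity>) + (-\<infinity>) = -\<infinity>\<close> and \<open>-\<infinity> \<le> -\<infinity>\<close>.
\<close>

definition eff_dom :: "'a set \<Rightarrow> ('a set \<Rightarrow> ereal) \<Rightarrow> 'a set set" where
  "eff_dom N f = {X. X \<subseteq> N \<and> f X > -\<infinity>}"

definition M_natural_concave :: "'a set \<Rightarrow> ('a set \<Rightarrow> ereal) \<Rightarrow> bool" where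
  "M_natural_concave N f \<longleftrightarrow>
     (\<forall>X. X \<subseteq> N \<longrightarrow> f X \<noteq> \<infinity>) \<and>
     eff_dom N f \<noteq> {} \<and>
     (\<forall>X \<in> eff_dom N f. \<forall>Y \<in> eff_dom N f. \<forall>i \<in> X - Y.
        (X - {i} \<in> eff_dom N f \<and> Y \<union> {i} \<in> eff_dom N f \<and>
           f X + f Y \<le> f (X - {i}) + f (Y \<union> {i})) \<or>
        (\<exists>j \<in> Y - X.
           (X - {i}) \<union> {j} \<in> eff_dom N f \<and> (Y \<union> {i}) - {j} \<in> eff_dom N f \<and>
           f X + f Y \<le> f ((X - {i}) \<union> {j}) + f ((Y \<union> {i}) - {j})))"

end

theory Submission
  imports Defs
begin

text \<open>
  The statement asks for one set \<open>J\<close> that serves two summands, \<open>f1 J = f ((X - I) \<union> J)\<close>, restricted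
  to \<open>card J \<le> card I\<close>, and \<open>f2 B = f ((X \<inter> Y) \<union> I \<union> B)\<close> at \<open>B = E - J\<close>, where \<open>E = Y - X\<close>. It is a
  problem of partitioning \<open>E\<close> between two agents, and it is solved by Lagrangian duality: put a price
  \<open>p e\<close> on every \<open>e \<in> E\<close> and let the agents choose sets \<open>A\<close> and \<open>B\<close> independently, an element taken
  twice earning its price and an element not taken paying it.

  The relaxed problem is easy. For fixed prices one has to find \<open>A\<close> with at most \<open>card I\<close>
  elements and \<open>B\<close> such that the total is at least \<open>f X + f Y\<close>. After the prices are absorbed into
  \<open>f\<close> this is submodularity: projecting out \<open>E\<close> by maximisation leaves a function of the
  remaining elements, and those in \<open>I\<close> can be moved from the large to the small set one by one; each move
  costs at most one element of \<open>E\<close>, which gives the bound on the cardinality (\<open>best_move\<close>).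

  There is no duality gap (\<open>exchange_partition\<close>). The constraints are imposed one element \<open>e\<close> at a
  time. If \<open>n0\<close>, \<open>n1\<close>, \<open>n2\<close> are the optimal values when \<open>e\<close> is taken by nobody, by exactly one agent, and
  by both, one application of the exchange axiom gives \<open>n0 + n2 \<le> 2 * n1\<close>
  (\<open>exchange_midpoint\<close>); so a price that makes both wrong choices worse than \<open>c\<close> exists as soon as
  \<open>n1 < c\<close>. The induction goes on because requiring that exactly one of two elements is taken, and
  then forgetting both, preserves the exchange axiom (\<open>exchange_merge\<close>). This is the heart of the
  proof. Both this and the truncation of \<open>f1\<close> rest on the form of the axiom with cardinalities: if
  \<open>card X \<le> card Y\<close>, then \<open>i\<close> can be exchanged against an element of \<open>Y\<close> (\<open>exchange_swap\<close>).
\<close>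

section \<open>The exchange axiom\<close>

text \<open>
  A left-hand side above \<open>-\<infinity>\<close> forces both terms on the right to be finite, so that the inequality
  alone places the new sets in the effective domain. The constant \<open>-\<infinity>\<close> is admitted because
  contraction, truncation and merging may produce it.
\<close>
definition exchange :: "'a set \<Rightarrow> ('a set \<Rightarrow> ereal) \<Rightarrow> bool" where
  "exchange V F \<longleftrightarrow>
     (\<forall>X \<subseteq> V. F X \<noteq> \<infinity>) \<and>
     (\<forall>X \<subseteq> V. \<forall>Y \<subseteq> V. \<forall>i \<in> X - Y.
        F X + F Y \<le> F (X - {i}) + F (insert i Y) \<or>
        (\<exists>j \<in> Y - X. F X + F Y \<le> F (insert j (X - {i})) + F (insert i (Y - {j}))))"

lemma exchangeI:
  assumes "\<And>X. X \<subseteq> V \<Longrightarrow> F X \<noteq> \<infinity>"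
    and "\<And>X Y i. \<lbrakk>X \<subseteq> V; Y \<subseteq> V; i \<in> X; i \<notin> Y; \<bar>F X\<bar> \<noteq> \<infinity>; \<bar>F Y\<bar> \<noteq> \<infinity>\<rbrakk> \<Longrightarrow>
      F X + F Y \<le> F (X - {i}) + F (insert i Y) \<or>
      (\<exists>j \<in> Y - X. F X + F Y \<le> F (insert j (X - {i})) + F (insert i (Y - {j})))"
  shows "exchange V F"
proof -
  show ?thesis
    unfolding exchange_def
  proof (intro conjI allI impI ballI)
    show "F X \<noteq> \<infinity>" if "X \<subseteq> V" for X
      using that by (rule assms(1))
  next
    fix X Y i
    assume XY: "X \<subseteq> V" "Y \<subseteq> V" and i: "i \<in> X - Y"
    show "F X + F Y \<le> F (X - {i}) + F (insert i Y) \<or>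
      (\<exists>j \<in> Y - X. F X + F Y \<le> F (insert j (X - {i})) + F (insert i (Y - {j})))"
    proof (cases "\<bar>F X\<bar> = \<infinity> \<or> \<bar>F Y\<bar> = \<infinity>")
      case True
      then have "F X + F Y = -\<infinity>"
        using assms(1)[OF XY(1)] assms(1)[OF XY(2)] by auto
      then show ?thesis
        by (simp only: ereal_less_eq simp_thms)
    next
      case False
      then show ?thesis
        using i by (intro assms(2)[OF XY]) auto
    qed
  qed
qed

lemma exchange_if_M_natural_concave:
  assumes "M_natural_concave N f"
  shows "exchange N f"
proof (rule exchangeI)
  show "f X \<noteq> \<infinity>" if "X \<subseteq> N" for X
    using assms that by (simp add: M_natural_concave_def)
next
  fix X Y i
  assume XY: "X \<subseteq> N" "Y \<subseteq> N" and i: "i \<in> X" "i \<notin> Y"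
    and "\<bar>f X\<bar> \<noteq> \<infinity>" "\<bar>f Y\<bar> \<noteq> \<infinity>"
  then have "X \<in> eff_dom N f" "Y \<in> eff_dom N f"
    by (auto simp: eff_dom_def)
  moreover have "i \<in> X - Y"
    using i by blast
  ultimately have "f X + f Y \<le> f (X - {i}) + f (Y \<union> {i}) \<or>
      (\<exists>j \<in> Y - X. f X + f Y \<le> f ((X - {i}) \<union> {j}) + f ((Y \<union> {i}) - {j}))"
    using assms unfolding M_natural_concave_def by meson
  moreover have "insert i (Y - {j}) = (Y \<union> {i}) - {j}" if "j \<in> Y" for j
    using that i by auto
  ultimately show "f X + f Y \<le> f (X - {i}) + f (insert i Y) \<or>
      (\<exists>j \<in> Y - X. f X + f Y \<le> f (insert j (X - {i})) + f (insert i (Y - {j})))"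
    by auto
qed

lemma exchange_not_PInf: "exchange V F \<Longrightarrow> X \<subseteq> V \<Longrightarrow> F X \<noteq> \<infinity>"
  by (simp add: exchange_def)

lemma exchange_cases:
  assumes "exchange V F" "X \<subseteq> V" "Y \<subseteq> V" "i \<in> X" "i \<notin> Y"
  obtains (move) "F X + F Y \<le> F (X - {i}) + F (insert i Y)"
  | (swap) j where "j \<in> Y" "j \<notin> X"
      "F X + F Y \<le> F (insert j (X - {i})) + F (insert i (Y - {j}))"
  using assms unfolding exchange_def by blast

text \<open>
  For \<open>Y \<subseteq> X\<close> there is nothing to swap with, so that the axiom becomes local submodularity.
\<close>
lemma exchange_nested:
  assumes "exchange V F" "X \<subseteq> V" "Y \<subseteq> X" "i \<in> X" "i \<notin> Y"
  shows "F X + F Y \<le> F (X - {i}) + F (insert i Y)"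
proof -
  have "Y \<subseteq> V"
    using assms by blast
  from assms(1,2) this assms(4,5) show ?thesis
    by (cases rule: exchange_cases) (use assms(3) in auto)
qed

text \<open>
  Adding two exchange inequalities and cancelling the finite terms common to both sides is the
  recurring argument below.
\<close>
lemma ereal_add_le_cancel:
  fixes x y a b u v :: ereal
  assumes "x + u \<le> a + v" "y + v \<le> b + u" "\<bar>u\<bar> \<noteq> \<infinity>" "\<bar>v\<bar> \<noteq> \<infinity>"
  shows "x + y \<le> a + b"
proof -
  obtain u' v' where "u = ereal u'" "v = ereal v'"
    using assms by auto
  with assms show ?thesis
    by (cases x; cases y; cases a; cases b) auto
qed

text \<open>
  The source of all prices: \<open>t\<close> makes up for the first summand exceeding \<open>x\<close> and still leaves the
  second one below \<open>y\<close>.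
\<close>
lemma ereal_price_between:
  fixes a b x y :: ereal
  assumes "a + b < x + y" "\<bar>x\<bar> \<noteq> \<infinity>" "\<bar>y\<bar> \<noteq> \<infinity>"
  obtains t :: real where "a < x + ereal t" "b + ereal t < y"
proof -
  obtain x' y' where xy: "x = ereal x'" "y = ereal y'"
    using assms by auto
  have "a - x < y - b"
    using assms(1) xy by (cases a; cases b) auto
  then obtain t where "a - x < ereal t" "ereal t < y - b"
    using ereal_dense2 by blast
  then have "a < x + ereal t" "b + ereal t < y"
    using xy by (cases a; cases b; auto)+
  then show ?thesis
    by (rule that)
qed

lemma finite_if_sum_finite:
  fixes a b x y :: ereal
  assumes "x + y \<le> a + b" "\<bar>x\<bar> \<noteq> \<infinity>" "\<bar>y\<bar> \<noteq> \<infinity>" "a \<noteq> \<infinity>" "b \<noteq> \<infinity>"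
  shows "\<bar>a\<bar> \<noteq> \<infinity>" "\<bar>b\<bar> \<noteq> \<infinity>"
  using assms by (cases x; cases y; cases a; cases b; auto)+

lemma ereal_add_le_less:
  fixes a b :: ereal
  assumes "a \<le> ereal s" "b < ereal t"
  shows "a + b < ereal (s + t)"
  using assms by (cases a; cases b) auto

section \<open>Exchange with control of cardinalities\<close>

text \<open>
  In a counterexample, every \<open>j \<in> Y - X\<close> has a price \<open>p j\<close> at which adding \<open>j\<close> to \<open>X\<close> and
  removing it from \<open>Y\<close> are both strictly bad. For some \<open>i \<in> X - Y\<close>, take the best set \<open>Z\<close>, in terms
  of priced values, among \<open>X - {i}\<close> and all \<open>insert j (X - {i})\<close>. It is closer to \<open>Y\<close> than \<open>X\<close> is, so
  by induction some \<open>insert k Z\<close> is better than \<open>Z\<close>; by the choice of \<open>Z\<close> it has the form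
  \<open>insert k (insert j (X - {i}))\<close>. Exchanging \<open>j\<close> between this set and \<open>X\<close> leads to one of the
  candidates for \<open>Z\<close> and to \<open>insert j X\<close> or \<open>insert k X\<close>, whose values are too small.
\<close>
lemma exchange_augment:
  assumes "exchange V F" "finite V" "X \<subseteq> V" "Y \<subseteq> V" "card X < card Y"
  shows "\<exists>j \<in> Y - X. F X + F Y \<le> F (insert j X) + F (Y - {j})"
  using assms(3,5)
proof (induction "card (X - Y)" arbitrary: X rule: less_induct)
  case less
  note ex = \<open>exchange V F\<close>
  have finX: "finite X" "finite Y"
    using less.prems assms finite_subset by blast+
  have "\<not> Y \<subseteq> X"
    using less.prems finX by (meson card_mono leD)
  then obtain j0 where j0: "j0 \<in> Y" "j0 \<notin> X"
    by blast
  show ?case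
  proof (rule ccontr)
    assume neg: "\<not> ?thesis"
    then have viol: "F (insert j X) + F (Y - {j}) < F X + F Y" if "j \<in> Y - X" for j
      using that by (meson not_le)
    have finF: "\<bar>F X\<bar> \<noteq> \<infinity>" "\<bar>F Y\<bar> \<noteq> \<infinity>"
      using viol[of j0] j0 exchange_not_PInf[OF ex] less.prems(1) \<open>Y \<subseteq> V\<close>
      by (cases "F X"; cases "F Y"; simp)+
    have "\<exists>t. F (insert j X) < F X + ereal t \<and> F (Y - {j}) + ereal t < F Y" if "j \<in> Y - X" for j
      using ereal_price_between[OF viol[OF that] finF] by metis
    then obtain p where p1: "\<And>j. j \<in> Y - X \<Longrightarrow> F (insert j X) < F X + ereal (p j)"
      and p2: "\<And>j. j \<in> Y - X \<Longrightarrow> F (Y - {j}) + ereal (p j) < F Y"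
      by metis
    show False
    proof (cases "X \<subseteq> Y")
      case True
      have "F Y + F X \<le> F (Y - {j0}) + F (insert j0 X)"
        using exchange_nested[OF ex \<open>Y \<subseteq> V\<close> True] j0 by blast
      then show False
        using viol[of j0] j0 by (simp add: add.commute)
    next
      case False
      then obtain i where i: "i \<in> X" "i \<notin> Y"
        by blast
      have IH: "\<exists>j \<in> Y - Z. F Z + F Y \<le> F (insert j Z) + F (Y - {j})"
        if "Z = X - {i} \<or> (\<exists>j \<in> Y - X. Z = insert j (X - {i}))" for Z
      proof (rule less.hyps)
        have "Z - Y = X - Y - {i}"
          using that by auto
        then show "card (Z - Y) < card (X - Y)"
          using i finX by (metis DiffI card_Diff1_less finite_Diff)
        show "Z \<subseteq> V"
          using that less.prems \<open>Y \<subseteq> V\<close> by auto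
        have "card Z \<le> card X"
          using that i finX card_Suc_Diff1[of X i] card_Diff1_le[of X i]
          by (auto simp: card_insert_if simp del: card_Diff_singleton)
        then show "card Z < card Y"
          using less.prems by simp
      qed
      define v where "v j = F (insert j (X - {i})) - ereal (p j)" for j
      define m where "m = Max (v ` (Y - X))"
      have m_ge: "v j \<le> m" if "j \<in> Y - X" for j
        unfolding m_def using that finX by auto
      have "m \<in> v ` (Y - X)"
        unfolding m_def using finX j0 by (intro Max_in) auto
      then obtain j where j: "j \<in> Y - X" "m = v j"
        by blast
      have npinf: "F Z \<noteq> \<infinity>" if "Z \<subseteq> X \<union> Y" for Z
        by (rule exchange_not_PInf[OF ex]) (use that less.prems \<open>Y \<subseteq> V\<close> in auto)
      have sub: "X - {i} \<subseteq> X \<union> Y" "insert k (X - {i}) \<subseteq> X \<union> Y" "insert i Y \<subseteq> X \<union> Y" 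
        "insert i (Y - {k}) \<subseteq> X \<union> Y" if "k \<in> Y" for k
        using that i by auto
      \<comment> \<open>The axiom for \<open>X\<close>, \<open>Y\<close> and \<open>i\<close> puts some candidate, hence also the best one, into the domain.\<close>
      have dom: "F (X - {i}) \<noteq> -\<infinity> \<or> m \<noteq> -\<infinity>"
        using ex less.prems(1) \<open>Y \<subseteq> V\<close> i
      proof (cases rule: exchange_cases)
        case move
        then show ?thesis
          using finite_if_sum_finite[OF move finF] npinf sub j by auto
      next
        case (swap k)
        then have "\<bar>F (insert k (X - {i}))\<bar> \<noteq> \<infinity>"
          using finite_if_sum_finite[OF swap(3) finF] npinf sub by auto
        then have "v k \<noteq> -\<infinity>"
          unfolding v_def by auto
        then show ?thesis
          using m_ge[of k] swap by auto
      qed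
      show False
      proof (cases "F (X - {i}) \<ge> m")
        case True
        with dom have d: "\<bar>F (X - {i})\<bar> \<noteq> \<infinity>"
          using npinf[of "X - {i}"] by auto
        obtain k where k: "k \<in> Y - (X - {i})" "F (X - {i}) + F Y \<le> F (insert k (X - {i})) + F (Y - {k})"
          using IH by blast
        have "F (insert k (X - {i})) - ereal (p k) \<le> F (X - {i})"
          using m_ge[of k] True k i unfolding v_def by force
        moreover have "F (Y - {k}) + ereal (p k) < F Y"
          using p2 k i by auto
        ultimately show False
          using k(2) d finF(2)
          by (cases "F (insert k (X - {i}))"; cases "F (Y - {k})"; cases "F (X - {i})"; cases "F Y") auto
      next
        case False
        define Z where "Z = insert j (X - {i})"
        have d: "\<bar>F Z\<bar> \<noteq> \<infinity>"
          using False j npinf[of Z] sub[of j] unfolding Z_def v_def by auto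
        obtain k where k: "k \<in> Y - Z" "F Z + F Y \<le> F (insert k Z) + F (Y - {k})"
          using IH j Z_def by blast
        have kX: "k \<in> Y - X" "k \<noteq> j"
          using k i Z_def by auto
        have big: "F Z + ereal (p k) < F (insert k Z)"
          using k(2) p2[OF kX(1)] d finF(2)
          by (cases "F (insert k Z)"; cases "F (Y - {k})"; cases "F Z"; cases "F Y") auto
        obtain x z where xz: "F X = ereal x" "F Z = ereal z"
          using finF(1) d by auto
        have "F (insert k Z) + F X < ereal (z + p k + x)"
        proof -
          have A: "insert k Z \<subseteq> V" "X \<subseteq> V" "j \<in> insert k Z" "j \<notin> X"
            using kX j less.prems \<open>Y \<subseteq> V\<close> unfolding Z_def by auto
          show ?thesis
            using ex A
          proof (cases rule: exchange_cases)
            case move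
            have e: "insert k Z - {j} = insert k (X - {i})"
              using kX j unfolding Z_def by auto
            have "v k \<le> v j"
              using m_ge[OF kX(1)] j by simp
            then have "F (insert k (X - {i})) \<le> ereal (z - p j + p k)"
              unfolding v_def Z_def[symmetric] xz by (cases "F (insert k (X - {i}))") auto
            moreover have "F (insert j X) < ereal (x + p j)"
              using p1[OF j(1)] xz by simp
            ultimately have "F (insert k (X - {i})) + F (insert j X) < ereal (z - p j + p k + (x + p j))"
              by (rule ereal_add_le_less)
            also have "z - p j + p k + (x + p j) = z + p k + x"
              by simp
            finally show ?thesis
              using move unfolding e by (rule le_less_trans[rotated])
          next
            case (swap l)
            then have l: "l = i"
              unfolding Z_def by auto
            have e: "insert l (insert k Z - {j}) = insert k X" "insert j (X - {l}) = Z"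
              using kX j i unfolding Z_def l by auto
            have "F Z + F (insert k X) < ereal (z + (x + p k))"
              using p1[OF kX(1)] xz by (intro ereal_add_le_less) auto
            also have "z + (x + p k) = z + p k + x"
              by simp
            finally show ?thesis
              using swap(3) unfolding e by (simp add: add.commute)
          qed
        qed
        then show False
          using big unfolding xz by (cases "F (insert k Z)") auto
      qed
    qed
  qed
qed

text \<open>
  Suppose that the axiom only moves \<open>i\<close> from \<open>X\<close> to \<open>Y\<close>. Since \<open>X - {i}\<close> is smaller than \<open>Y\<close>, some \<open>j\<close>
  can be moved back from \<open>Y\<close>, and submodularity at \<open>insert i Y\<close> and \<open>Y - {j}\<close> shows that the two moves can be
  made together.
\<close>
lemma exchange_swap:
  assumes ex: "exchange V F" and "finite V" "X \<subseteq> V" "Y \<subseteq> V" "card X \<le> card Y"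
    and i: "i \<in> X" "i \<notin> Y"
  obtains j where "j \<in> Y" "j \<notin> X"
    "F X + F Y \<le> F (insert j (X - {i})) + F (insert i (Y - {j}))"
proof (cases "\<bar>F X\<bar> = \<infinity> \<or> \<bar>F Y\<bar> = \<infinity>")
  case True
  then have minf: "F X + F Y = -\<infinity>"
    using exchange_not_PInf[OF ex] assms by auto
  have "\<not> Y \<subseteq> X"
    using assms by (metis card_seteq finite_subset)
  then obtain j where "j \<in> Y" "j \<notin> X"
    by blast
  then show ?thesis
    by (rule that) (unfold minf, simp)
next
  case False
  from ex \<open>X \<subseteq> V\<close> \<open>Y \<subseteq> V\<close> i show ?thesis
  proof (cases rule: exchange_cases)
    case (swap j)
    then show ?thesis
      by (rule that)
  next
    case move
    have fin: "finite X" "finite Y"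
      using assms finite_subset by blast+
    have "card (X - {i}) < card Y"
      using fin i \<open>card X \<le> card Y\<close> by (meson card_Diff1_less less_le_trans)
    then obtain j where j: "j \<in> Y - (X - {i})"
      "F (X - {i}) + F Y \<le> F (insert j (X - {i})) + F (Y - {j})"
      using exchange_augment[OF ex \<open>finite V\<close>, of "X - {i}" Y] assms by blast
    have jX: "j \<in> Y" "j \<notin> X"
      using j i by auto
    have "F (insert i Y) + F (Y - {j}) \<le> F (insert i Y - {i}) + F (insert i (Y - {j}))"
      using exchange_nested[OF ex, of "insert i Y" "Y - {j}" i] assms by auto
    then have n: "F (insert i Y) + F (Y - {j}) \<le> F (insert i (Y - {j})) + F Y"
      using i by (simp add: add.commute)
    have np: "F Z \<noteq> \<infinity>" if "Z \<subseteq> X \<union> Y" for Z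
      by (rule exchange_not_PInf[OF ex]) (use that assms in auto)
    have "\<bar>F (X - {i})\<bar> \<noteq> \<infinity>"
      by (rule finite_if_sum_finite(1)[OF move])
        (use False i np[of "X - {i}"] np[of "insert i Y"] in auto)
    then have "\<bar>F (Y - {j})\<bar> \<noteq> \<infinity>"
      by (intro finite_if_sum_finite(2)[OF j(2)]) (use False jX np[of "Y - {j}"] np[of "insert j (X - {i})"] in auto)
    with False have "F (X - {i}) + F (insert i Y) \<le> F (insert j (X - {i})) + F (insert i (Y - {j}))"
      by (intro ereal_add_le_cancel[OF j(2) n]) auto
    with move jX show ?thesis
      using that order_trans by blast
  qed
qed

section \<open>Operations that preserve the exchange axiom\<close>

lemma exchange_contract:
  assumes ex: "exchange V F" and K: "K \<union> E \<subseteq> V" "K \<inter> E = {}"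
  shows "exchange E (\<lambda>A. F (K \<union> A))"
proof (rule exchangeI)
  show "F (K \<union> X) \<noteq> \<infinity>" if "X \<subseteq> E" for X
    by (rule exchange_not_PInf[OF ex]) (use that K in auto)
next
  fix X Y i
  assume XY: "X \<subseteq> E" "Y \<subseteq> E" and i: "i \<in> X" "i \<notin> Y"
  have e: "K \<union> X - {i} = K \<union> (X - {i})" "insert i (K \<union> Y) = K \<union> insert i Y"
    using i XY K by auto
  have "K \<union> X \<subseteq> V" "K \<union> Y \<subseteq> V" "i \<in> K \<union> X" "i \<notin> K \<union> Y"
    using i XY K by auto
  with ex show "F (K \<union> X) + F (K \<union> Y) \<le> F (K \<union> (X - {i})) + F (K \<union> insert i Y) \<or>
    (\<exists>j \<in> Y - X. F (K \<union> X) + F (K \<union> Y) \<le>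
      F (K \<union> insert j (X - {i})) + F (K \<union> insert i (Y - {j})))"
  proof (cases rule: exchange_cases)
    case move
    then show ?thesis
      unfolding e by (rule disjI1)
  next
    case (swap j)
    have e': "insert j (K \<union> X - {i}) = K \<union> insert j (X - {i})"
      "insert i (K \<union> Y - {j}) = K \<union> insert i (Y - {j})"
      using i XY K swap by auto
    have "j \<in> Y - X"
      using swap by auto
    with swap(3)[unfolded e'] show ?thesis
      by (intro disjI2 bexI)
  qed
qed

text \<open>
  The move of \<open>i\<close> into \<open>Y\<close> violates the bound only if \<open>card Y = k\<close>; but then \<open>card X \<le> card Y\<close>
  and a swap exists.
\<close>
lemma exchange_truncate:
  assumes ex: "exchange V F" and fin: "finite V"
  shows "exchange V (\<lambda>A. if card A \<le> k then F A else -\<infinity>)"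
proof (rule exchangeI)
  show "(if card X \<le> k then F X else -\<infinity>) \<noteq> \<infinity>" if "X \<subseteq> V" for X
    using exchange_not_PInf[OF ex that] by simp
next
  fix X Y i
  assume XY: "X \<subseteq> V" "Y \<subseteq> V" and i: "i \<in> X" "i \<notin> Y"
    and d: "\<bar>if card X \<le> k then F X else -\<infinity>\<bar> \<noteq> \<infinity>" "\<bar>if card Y \<le> k then F Y else -\<infinity>\<bar> \<noteq> \<infinity>"
  have card: "card X \<le> k" "card Y \<le> k"
    using d by (auto split: if_splits)
  have finXY: "finite X" "finite Y"
    using XY fin finite_subset by blast+
  let ?T = "\<lambda>A. if card A \<le> k then F A else -\<infinity>"
  let ?goal = "?T X + ?T Y \<le> ?T (X - {i}) + ?T (insert i Y) \<or>
    (\<exists>j \<in> Y - X. ?T X + ?T Y \<le> ?T (insert j (X - {i})) + ?T (insert i (Y - {j})))"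
  have swapped: ?goal if j: "j \<in> Y" "j \<notin> X"
    "F X + F Y \<le> F (insert j (X - {i})) + F (insert i (Y - {j}))" for j
  proof -
    have "card (insert j (X - {i})) \<le> k" "card (insert i (Y - {j})) \<le> k"
      using card i j finXY card_Suc_Diff1[of X i] card_Suc_Diff1[of Y j]
      by (simp_all add: card_insert_if del: card_Diff_singleton)
    then have "?T X + ?T Y \<le> ?T (insert j (X - {i})) + ?T (insert i (Y - {j}))"
      using card j by simp
    then show ?goal
      using j by blast
  qed
  show ?goal
  proof (cases "card Y < k")
    case False
    then have "card X \<le> card Y"
      using card by simp
    then show ?thesis
      using exchange_swap[OF ex fin XY _ i] swapped by blast
  next
    case True
    from ex XY i show ?thesis
    proof (cases rule: exchange_cases)
      case move
      have "card (X - {i}) \<le> k" "card (insert i Y) \<le> k"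
        using True card i finXY by (auto simp: card_insert_if)
      with move card show ?thesis
        by simp
    next
      case (swap j)
      then show ?thesis
        by (rule swapped)
    qed
  qed
qed

lemma exchange_add_modular:
  fixes S :: "'a set \<Rightarrow> real"
  assumes ex: "exchange V F"
    and S: "\<And>X Y i. i \<in> X \<Longrightarrow> i \<notin> Y \<Longrightarrow> S (X - {i}) + S (insert i Y) = S X + S Y"
  shows "exchange V (\<lambda>X. F X + ereal (S X))"
proof (rule exchangeI)
  show "F X + ereal (S X) \<noteq> \<infinity>" if "X \<subseteq> V" for X
    using exchange_not_PInf[OF ex that] by simp
next
  fix X Y i
  assume XY: "X \<subseteq> V" "Y \<subseteq> V" and i: "i \<in> X" "i \<notin> Y"
  have add: "(a + ereal s) + (b + ereal t) \<le> (a' + ereal s') + (b' + ereal t')"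
    if "a + b \<le> a' + b'" "s' + t' = s + t" for a b a' b' s t s' t'
  proof -
    have e: "(a + ereal s) + (b + ereal t) = (a + b) + ereal (s + t)" for a b s t
      by (cases a; cases b) auto
    show ?thesis
      unfolding e that(2) using that(1) by (rule add_right_mono)
  qed
  from ex XY i show "F X + ereal (S X) + (F Y + ereal (S Y))
      \<le> F (X - {i}) + ereal (S (X - {i})) + (F (insert i Y) + ereal (S (insert i Y))) \<or>
    (\<exists>j \<in> Y - X. F X + ereal (S X) + (F Y + ereal (S Y))
      \<le> F (insert j (X - {i})) + ereal (S (insert j (X - {i}))) +
        (F (insert i (Y - {j})) + ereal (S (insert i (Y - {j})))))"
  proof (cases rule: exchange_cases)
    case move
    show ?thesis
      using add[OF move S[OF i]] by blast
  next
    case (swap j)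
    have "S (insert j (X - {i})) + S (insert i (Y - {j})) = S X + S Y"
      using S[OF i(1), of "Y - {j}"] S[OF swap(1), of "X - {i}"] i swap(2) by fastforce
    from add[OF swap(3) this] swap show ?thesis
      by blast
  qed
qed

text \<open>
  Subsets of \<open>V \<times> UNIV\<close> with \<^typ>\<open>bool\<close> as second component encode the pairs of subsets of \<open>V\<close>.
\<close>
definition layer :: "'b \<Rightarrow> ('a \<times> 'b) set \<Rightarrow> 'a set" where
  "layer b Z = {a. (a, b) \<in> Z}"

lemma layer_simps [simp]:
  "layer b (insert (a, c) Z) = (if b = c then insert a (layer b Z) else layer b Z)"
  "layer b (Z - {(a, c)}) = (if b = c then layer b Z - {a} else layer b Z)"
  "a \<in> layer b Z \<longleftrightarrow> (a, b) \<in> Z"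
  by (auto simp: layer_def)

lemma layer_subset: "Z \<subseteq> V \<times> UNIV \<Longrightarrow> layer b Z \<subseteq> V"
  by (auto simp: layer_def)

lemma exchange_direct_sum:
  assumes F: "exchange V F" and G: "exchange V G"
  shows "exchange (V \<times> UNIV) (\<lambda>Z. F (layer True Z) + G (layer False Z))"
proof (rule exchangeI)
  show "F (layer True X) + G (layer False X) \<noteq> \<infinity>" if "X \<subseteq> V \<times> UNIV" for X
    using exchange_not_PInf[OF F layer_subset[OF that, of True]]
      exchange_not_PInf[OF G layer_subset[OF that, of False]] by simp
next
  let ?H = "\<lambda>Z. F (layer True Z) + G (layer False Z)"
  fix X Y :: "('a \<times> bool) set" and i
  assume XY: "X \<subseteq> V \<times> UNIV" "Y \<subseteq> V \<times> UNIV" and i: "i \<in> X" "i \<notin> Y"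
  have l: "layer b X \<subseteq> V" "layer b Y \<subseteq> V" for b
    by (rule layer_subset[OF XY(1)], rule layer_subset[OF XY(2)])
  have add: "(a + b) + (a' + b') \<le> (c + d) + (c' + d')"
    if "a + a' \<le> c + c'" "b + b' \<le> d + d'" for a a' b b' c c' d d' :: ereal
  proof -
    have e: "(a + b) + (a' + b') = (a + a') + (b + b')" for a b a' b' :: ereal
      by (simp only: ac_simps)
    show ?thesis
      unfolding e using that by (rule add_mono)
  qed
  obtain a b where ab: "i = (a, b)"
    by (cases i)
  let ?swap = "\<lambda>i. \<exists>j \<in> Y - X. ?H X + ?H Y \<le> ?H (insert j (X - {i})) + ?H (insert i (Y - {j}))"
  show "?H X + ?H Y \<le> ?H (X - {i}) + ?H (insert i Y) \<or> ?swap i"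
  proof (cases b)
    case True
    have lay: "layer True (insert (c, True) Z) = insert c (layer True Z)"
      "layer False (insert (c, True) Z) = layer False Z"
      "layer True (Z - {(c, True)}) = layer True Z - {c}"
      "layer False (Z - {(c, True)}) = layer False Z" for c :: 'a and Z
      by simp_all
    have i': "i = (a, True)"
      using ab True by simp
    then have "a \<in> layer True X" "a \<notin> layer True Y"
      using i by simp_all
    with F l show ?thesis
      unfolding i'
    proof (cases rule: exchange_cases)
      case move
      show "?H X + ?H Y \<le> ?H (X - {(a, True)}) + ?H (insert (a, True) Y) \<or> ?swap (a, True)"
        unfolding lay by (rule disjI1) (rule add[OF move order_refl])
    next
      case (swap j)
      then have "(j, True) \<in> Y - X"
        by simp
      moreover have "?H X + ?H Y \<le>
          ?H (insert (j, True) (X - {(a, True)})) + ?H (insert (a, True) (Y - {(j, True)}))"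
        unfolding lay by (rule add[OF swap(3) order_refl])
      ultimately show "?H X + ?H Y \<le> ?H (X - {(a, True)}) + ?H (insert (a, True) Y) \<or> ?swap (a, True)"
        by (intro disjI2 bexI)
    qed
  next
    case False
    have lay: "layer False (insert (c, False) Z) = insert c (layer False Z)"
      "layer True (insert (c, False) Z) = layer True Z"
      "layer False (Z - {(c, False)}) = layer False Z - {c}"
      "layer True (Z - {(c, False)}) = layer True Z" for c :: 'a and Z
      by simp_all
    have i': "i = (a, False)"
      using ab False by simp
    then have "a \<in> layer False X" "a \<notin> layer False Y"
      using i by simp_all
    with G l show ?thesis
      unfolding i'
    proof (cases rule: exchange_cases)
      case move
      show "?H X + ?H Y \<le> ?H (X - {(a, False)}) + ?H (insert (a, False) Y) \<or> ?swap (a, False)"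
        unfolding lay by (rule disjI1) (rule add[OF order_refl move])
    next
      case (swap j)
      then have "(j, False) \<in> Y - X"
        by simp
      moreover have "?H X + ?H Y \<le>
          ?H (insert (j, False) (X - {(a, False)})) + ?H (insert (a, False) (Y - {(j, False)}))"
        unfolding lay by (rule add[OF order_refl swap(3)])
      ultimately show "?H X + ?H Y \<le> ?H (X - {(a, False)}) + ?H (insert (a, False) Y) \<or> ?swap (a, False)"
        by (intro disjI2 bexI)
    qed
  qed
qed

section \<open>Requiring exactly one of two elements\<close>

definition merge :: "'a \<Rightarrow> 'a \<Rightarrow> ('a set \<Rightarrow> ereal) \<Rightarrow> 'a set \<Rightarrow> ereal" where
  "merge a b F Z = max (F (insert a Z)) (F (insert b Z))"

lemma merge_commute: "merge a b F = merge b a F"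
  by (auto simp: merge_def max.commute)

text \<open>
  The only delicate case is that \<open>X\<close> uses \<open>a\<close>, \<open>Y\<close> uses \<open>b\<close>, and the axiom exchanges \<open>i\<close> against
  \<open>b\<close>. This leads to \<open>W = insert a (insert b (X - {i}))\<close>, which has both elements, and
  \<open>U = insert i Y\<close>, which has neither. Exchanging \<open>a\<close> between \<open>W\<close> and \<open>U\<close> either succeeds or undoes the
  move of \<open>i\<close>, with the roles of \<open>a\<close> and \<open>b\<close> interchanged. In the latter case all inequalities met
  so far are equalities; in particular \<open>insert a Y\<close> is as good as \<open>insert b Y\<close>. Then \<open>b\<close>
  is exchanged between \<open>W\<close> and \<open>insert a Y\<close>, which produces a set \<open>T\<close> that contains both \<open>a\<close> and \<open>b\<close>,
  and \<open>a\<close> is exchanged between \<open>T\<close> and \<open>U\<close>. In the sum of the two inequalities \<open>F T\<close> and the value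
  at \<open>Y\<close> cancel, and the required exchange for \<open>X\<close> and \<open>Y\<close> remains.
\<close>
lemma merge_exchange_distinct:
  assumes ex: "exchange V F" and fin: "finite V" and ab: "a \<in> V" "b \<in> V" "a \<noteq> b"
    and XY: "X \<subseteq> V - {a, b}" "Y \<subseteq> V - {a, b}" and i: "i \<in> X" "i \<notin> Y"
    and d: "\<bar>merge a b F X\<bar> \<noteq> \<infinity>" "\<bar>merge a b F Y\<bar> \<noteq> \<infinity>"
    and MX: "merge a b F X = F (insert a X)" and MY: "merge a b F Y = F (insert b Y)"
  shows "merge a b F X + merge a b F Y \<le> merge a b F (X - {i}) + merge a b F (insert i Y) \<or>
    (\<exists>j \<in> Y - X. merge a b F X + merge a b F Y
       \<le> merge a b F (insert j (X - {i})) + merge a b F (insert i (Y - {j})))"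
    (is "?goal")
proof -
  let ?M = "merge a b F"
  have ge: "F (insert a Z) \<le> ?M Z" "F (insert b Z) \<le> ?M Z" for Z
    by (auto simp: merge_def)
  have ia: "i \<noteq> a" "i \<noteq> b"
    using i XY by auto
  have np: "F Z \<noteq> \<infinity>" if "Z \<subseteq> X \<union> Y \<union> {a, b}" for Z
    by (rule exchange_not_PInf[OF ex]) (use that XY ab in auto)
  have moved: ?goal if "?M X + ?M Y \<le> p + q" "p \<le> ?M (X - {i})" "q \<le> ?M (insert i Y)" for p q
    using order_trans[OF that(1) add_mono[OF that(2,3)]] by blast
  have swapped: ?goal
    if "j \<in> Y" "j \<notin> X" "?M X + ?M Y \<le> p + q"
      "p \<le> ?M (insert j (X - {i}))" "q \<le> ?M (insert i (Y - {j}))" for p q j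
    using order_trans[OF that(3) add_mono[OF that(4,5)]] that(1,2) by blast
  have "insert a X \<subseteq> V" "insert b Y \<subseteq> V" "i \<in> insert a X" "i \<notin> insert b Y"
    using XY ab i ia by auto
  with ex show ?goal
  proof (cases rule: exchange_cases)
    case move
    moreover have "insert a X - {i} = insert a (X - {i})" "insert i (insert b Y) = insert b (insert i Y)"
      using ia by auto
    ultimately show ?thesis
      using moved ge MX MY by metis
  next
    case (swap j)
    show ?thesis
    proof (cases "j = b")
      case False
      then have "insert j (insert a X - {i}) = insert a (insert j (X - {i}))"
        "insert i (insert b Y - {j}) = insert b (insert i (Y - {j}))" "j \<in> Y" "j \<notin> X"
        using swap ia by auto
      then show ?thesis
        using swapped[of j] ge swap(3) MX MY by metis
    next
      case True
      define W where "W = insert a (insert b (X - {i}))"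
      define U where "U = insert i Y"
      have "insert j (insert a X - {i}) = W" "insert i (insert b Y - {j}) = U"
        using True XY ia unfolding W_def U_def by auto
      with swap(3) MX MY have WU: "?M X + ?M Y \<le> F W + F U"
        by simp
      have dWU: "\<bar>F W\<bar> \<noteq> \<infinity>" "\<bar>F U\<bar> \<noteq> \<infinity>"
        by (rule finite_if_sum_finite[OF WU d]; use np[of W] np[of U] i in \<open>auto simp: W_def U_def\<close>)+
      have sV: "W \<subseteq> V" "U \<subseteq> V"
        using XY ab i unfolding W_def U_def by auto
      have aWU: "a \<in> W" "a \<notin> U"
        using XY ia unfolding W_def U_def by auto
      from ex sV aWU show ?thesis
      proof (cases rule: exchange_cases)
        case move
        have "W - {a} = insert b (X - {i})" "insert a U = insert a (insert i Y)"
          using XY ab unfolding W_def U_def by auto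
        then show ?thesis
          using moved order_trans[OF WU move] ge by metis
      next
        case (swap l)
        show ?thesis
        proof (cases "l = i")
          case False
          then have "l \<in> Y" "l \<notin> X" "insert l (W - {a}) = insert b (insert l (X - {i}))"
            "insert a (U - {l}) = insert a (insert i (Y - {l}))"
            using swap XY ab unfolding W_def U_def by auto
          then show ?thesis
            using swapped[of l] order_trans[OF WU swap(3)] ge by metis
        next
          case True
          have "insert l (W - {a}) = insert b X" "insert a (U - {l}) = insert a Y"
            using True XY ab i unfolding W_def U_def by auto
          then have "?M X + ?M Y \<le> F (insert b X) + F (insert a Y)"
            using order_trans[OF WU swap(3)] by simp
          \<comment> \<open>Neither summand on the right exceeds its counterpart on the left, so both are equal.\<close>
          then have aY: "F (insert a Y) = ?M Y"
            using ge(2)[of X] ge(1)[of Y] d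
            by (cases "?M X"; cases "?M Y"; cases "F (insert b X)"; cases "F (insert a Y)") auto
          have "insert a Y \<subseteq> V" "b \<in> W" "b \<notin> insert a Y"
            using XY ab unfolding W_def by auto
          with ex sV(1) show ?thesis
          proof (cases rule: exchange_cases)
            case move
            define T where "T = insert b (insert a Y)"
            have "W - {b} = insert a (X - {i})"
              using XY ab unfolding W_def by auto
            then have 1: "F W + ?M Y \<le> ?M (X - {i}) + F T"
              using move ge(1)[of "X - {i}"] aY unfolding T_def
              by (metis add_right_mono order_trans)
            have dT: "\<bar>F T\<bar> \<noteq> \<infinity>"
            proof (rule finite_if_sum_finite(2)[OF move[folded T_def]])
              show "F (W - {b}) \<noteq> \<infinity>" "F T \<noteq> \<infinity>"
                by (rule np; auto simp: W_def T_def)+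
            qed (use aY d dWU in simp_all)
            have T: "T \<subseteq> V" "a \<in> T"
              using XY ab unfolding T_def by auto
            from ex T(1) sV(2) T(2) aWU(2) have 2: "F U + F T \<le> ?M (insert i Y) + ?M Y"
            proof (cases rule: exchange_cases)
              case move
              have "T - {a} = insert b Y"
                using XY ab unfolding T_def by auto
              then have "F T + F U \<le> F (insert b Y) + F (insert a (insert i Y))"
                using move unfolding U_def by simp
              also have "\<dots> \<le> ?M Y + ?M (insert i Y)"
                by (intro add_mono ge)
              finally show ?thesis
                by (simp add: add.commute)
            next
              case (swap m)
              then have "m = i"
                unfolding T_def U_def by auto
              then have "insert m (T - {a}) = insert b (insert i Y)" "insert a (U - {m}) = insert a Y"
                using XY ab i unfolding T_def U_def by auto
              then have "F T + F U \<le> F (insert b (insert i Y)) + F (insert a Y)"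
                using swap by simp
              also have "\<dots> \<le> ?M (insert i Y) + ?M Y"
                by (intro add_mono ge)
              finally show ?thesis
                by (simp add: add.commute)
            qed
            have "F W + F U \<le> ?M (X - {i}) + ?M (insert i Y)"
              using ereal_add_le_cancel[OF 1 2 d(2) dT] .
            then show ?thesis
              using moved order_trans[OF WU] by blast
          next
            case (swap k)
            then have k: "k \<in> Y" "k \<notin> X" "k \<noteq> a" "k \<noteq> b" "k \<noteq> i"
              using XY ab i unfolding W_def by auto
            define T where "T = insert b (insert a (Y - {k}))"
            have e: "insert k (W - {b}) = insert a (insert k (X - {i}))" "insert b (insert a Y - {k}) = T"
              using XY ab k unfolding W_def T_def by auto
            have 1: "F W + ?M Y \<le> ?M (insert k (X - {i})) + F T"
              using swap(3) ge(1)[of "insert k (X - {i})"] aY unfolding e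
              by (metis add_right_mono order_trans)
            have dT: "\<bar>F T\<bar> \<noteq> \<infinity>"
            proof (rule finite_if_sum_finite(2)[OF swap(3)[unfolded e(2)]])
              show "F (insert k (W - {b})) \<noteq> \<infinity>" "F T \<noteq> \<infinity>"
                using k(1) by (intro np; auto simp: W_def T_def)+
            qed (use aY d dWU in simp_all)
            have fY: "finite Y"
              using XY fin by (meson finite_Diff finite_subset)
            \<comment> \<open>A mere move of \<open>a\<close> would leave \<open>insert b (Y - {k})\<close>, about which nothing is known;
              equal cardinalities guarantee a swap.\<close>
            have "card T = card U"
              using k i ab XY fY card_Suc_Diff1[of Y k] unfolding T_def U_def
              by (auto simp: card_insert_if simp del: card_Diff_singleton)
            moreover have "T \<subseteq> V" "a \<in> T" "a \<notin> U"
              using XY ab ia unfolding T_def U_def by auto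
            ultimately obtain m where m: "m \<in> U" "m \<notin> T"
              "F T + F U \<le> F (insert m (T - {a})) + F (insert a (U - {m}))"
              using exchange_swap[OF ex fin _ sV(2), of T a] by (metis order_refl)
            have 2: "F U + F T \<le> ?M (insert i (Y - {k})) + ?M Y"
            proof (cases "m = i")
              case True
              then have "insert m (T - {a}) = insert b (insert i (Y - {k}))" "insert a (U - {m}) = insert a Y"
                using XY ab i unfolding T_def U_def by auto
              then have "F T + F U \<le> F (insert b (insert i (Y - {k}))) + F (insert a Y)"
                using m by simp
              also have "\<dots> \<le> ?M (insert i (Y - {k})) + ?M Y"
                by (intro add_mono ge)
              finally show ?thesis
                by (simp add: add.commute)
            next
              case False
              then have "m = k"
                using m unfolding T_def U_def by auto
              then have "insert m (T - {a}) = insert b Y"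
                "insert a (U - {m}) = insert a (insert i (Y - {k}))"
                using XY ab k unfolding T_def U_def by auto
              then have "F T + F U \<le> F (insert b Y) + F (insert a (insert i (Y - {k})))"
                using m by simp
              also have "\<dots> \<le> ?M Y + ?M (insert i (Y - {k}))"
                by (intro add_mono ge)
              finally show ?thesis
                by (simp add: add.commute)
            qed
            have "F W + F U \<le> ?M (insert k (X - {i})) + ?M (insert i (Y - {k}))"
              using ereal_add_le_cancel[OF 1 2 d(2) dT] .
            then show ?thesis
              using swapped[OF k(1,2)] order_trans[OF WU] by blast
          qed
        qed
      qed
    qed
  qed
qed

lemma exchange_merge:
  assumes ex: "exchange V F" and fin: "finite V" and ab: "a \<in> V" "b \<in> V" "a \<noteq> b"
  shows "exchange (V - {a, b}) (merge a b F)"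
proof (rule exchangeI)
  show "merge a b F X \<noteq> \<infinity>" if "X \<subseteq> V - {a, b}" for X
    using exchange_not_PInf[OF ex, of "insert a X"] exchange_not_PInf[OF ex, of "insert b X"] that ab
    by (auto simp: merge_def max_def)
next
  let ?M = "merge a b F"
  fix X Y i
  assume XY: "X \<subseteq> V - {a, b}" "Y \<subseteq> V - {a, b}" and i: "i \<in> X" "i \<notin> Y"
    and d: "\<bar>?M X\<bar> \<noteq> \<infinity>" "\<bar>?M Y\<bar> \<noteq> \<infinity>"
  let ?goal = "?M X + ?M Y \<le> ?M (X - {i}) + ?M (insert i Y) \<or>
    (\<exists>j \<in> Y - X. ?M X + ?M Y \<le> ?M (insert j (X - {i})) + ?M (insert i (Y - {j})))"
  have same: ?goal if c: "c \<in> {a, b}" and M: "?M X = F (insert c X)" "?M Y = F (insert c Y)" for c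
  proof -
    have ge: "F (insert c Z) \<le> ?M Z" for Z
      using c by (auto simp: merge_def)
    have ci: "c \<noteq> i"
      using c i XY by auto
    have "insert c X \<subseteq> V" "insert c Y \<subseteq> V" "i \<in> insert c X" "i \<notin> insert c Y"
      using XY ab c i by auto
    with ex show ?goal
    proof (cases rule: exchange_cases)
      case move
      have "insert c X - {i} = insert c (X - {i})" "insert i (insert c Y) = insert c (insert i Y)"
        using ci by auto
      with move M have "?M X + ?M Y \<le> F (insert c (X - {i})) + F (insert c (insert i Y))"
        by simp
      also have "\<dots> \<le> ?M (X - {i}) + ?M (insert i Y)"
        by (intro add_mono ge)
      finally show ?goal
        by blast
    next
      case (swap j)
      then have "insert j (insert c X - {i}) = insert c (insert j (X - {i}))"
        "insert i (insert c Y - {j}) = insert c (insert i (Y - {j}))"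
        using ci by auto
      with swap M have "?M X + ?M Y \<le> F (insert c (insert j (X - {i}))) + F (insert c (insert i (Y - {j})))"
        by simp
      also have "\<dots> \<le> ?M (insert j (X - {i})) + ?M (insert i (Y - {j}))"
        by (intro add_mono ge)
      finally show ?goal
        using swap by auto
    qed
  qed
  have cX: "?M X = F (insert a X) \<or> ?M X = F (insert b X)"
    and cY: "?M Y = F (insert a Y) \<or> ?M Y = F (insert b Y)"
    by (auto simp: merge_def max_def)
  consider c where "c \<in> {a, b}" "?M X = F (insert c X)" "?M Y = F (insert c Y)"
    | "?M X = F (insert a X)" "?M Y = F (insert b Y)"
    | "?M X = F (insert b X)" "?M Y = F (insert a Y)"
    using cX cY by blast
  then show ?goal
  proof cases
    case 1
    then show ?thesis
      by (rule same)
  next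
    case 2
    show ?thesis
      by (rule merge_exchange_distinct[OF ex fin ab XY i d 2])
  next
    case 3
    have s: "V - {a, b} = V - {b, a}"
      by auto
    show ?thesis
      using merge_exchange_distinct[OF ex fin ab(2,1) ab(3)[symmetric], of X Y i] XY i d 3
      unfolding merge_commute[of b a] s by blast
  qed
qed

section \<open>Partitioning without a duality gap\<close>

text \<open>
  This is the Lagrangian term \<open>\<Sum>e\<in>E. p e * (k e - 1)\<close>, where \<open>k e\<close> is the number of layers of \<open>Z\<close> that
  contain \<open>e\<close>. It vanishes if \<open>Z\<close> encodes a partition of \<open>E\<close>.
\<close>
definition excess :: "'a set \<Rightarrow> ('a \<Rightarrow> real) \<Rightarrow> ('a \<times> bool) set \<Rightarrow> real" where
  "excess E p Z = sum p (E \<inter> layer True Z) + sum p (E \<inter> layer False Z) - sum p E"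

lemma sum_Int_modular:
  fixes p :: "'a \<Rightarrow> real"
  assumes "finite E" "i \<in> X" "i \<notin> Y"
  shows "sum p (E \<inter> (X - {i})) + sum p (E \<inter> insert i Y) = sum p (E \<inter> X) + sum p (E \<inter> Y)"
proof (cases "i \<in> E")
  case True
  have "E \<inter> (X - {i}) = E \<inter> X - {i}"
    by auto
  then show ?thesis
    using True assms by (simp add: sum_diff1)
next
  case False
  then have "E \<inter> (X - {i}) = E \<inter> X" "E \<inter> insert i Y = E \<inter> Y"
    by auto
  then show ?thesis
    by simp
qed

lemma excess_modular:
  assumes "finite E" "i \<in> X" "i \<notin> Y"
  shows "excess E p (X - {i}) + excess E p (insert i Y) = excess E p X + excess E p Y"
proof -
  obtain a b where i: "i = (a, b)"
    by fastforce
  then have "a \<in> layer b X" "a \<notin> layer b Y"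
    using assms by auto
  from sum_Int_modular[OF assms(1) this, of p] show ?thesis
    by (cases b) (simp_all add: excess_def i)
qed

lemma excess_insert_element:
  assumes "finite E" "e \<notin> E"
  shows "excess (insert e E) (p(e := t)) Z =
    excess E p Z + t * (of_bool ((e, True) \<in> Z) + of_bool ((e, False) \<in> Z) - 1)"
proof -
  have s: "sum (p(e := t)) A = sum p A" if "A \<subseteq> E" for A
    using that assms by (intro sum.cong) auto
  have "sum (p(e := t)) (insert e E \<inter> L) = sum p (E \<inter> L) + t * of_bool (e \<in> L)" for L
    using assms s[of "E \<inter> L"] by (auto simp: Int_insert_left)
  moreover have "sum (p(e := t)) (insert e E) = sum p E + t"
    using assms s[of E] by simp
  ultimately show ?thesis
    by (simp add: excess_def algebra_simps)
qed

lemma excess_insert_outside: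
  assumes "e \<notin> E"
  shows "excess E p (insert (e, b) Z) = excess E p Z"
proof -
  have "E \<inter> insert e L = E \<inter> L" for L
    using assms by auto
  then show ?thesis
    by (auto simp: excess_def)
qed

text \<open>
  Exchanging \<open>a\<close> leaves exactly one of \<open>a\<close> and \<open>b\<close> in either set. This is discrete concavity of
  the optimal value in the number of elements of \<open>{a, b}\<close> that are taken.
\<close>
lemma exchange_midpoint:
  assumes ex: "exchange V F" and ab: "a \<in> V" "b \<in> V" "a \<noteq> b"
    and XY: "X \<subseteq> V - {a, b}" "Y \<subseteq> V - {a, b}"
  shows "\<exists>Z \<subseteq> V - {a, b}. \<exists>Z' \<subseteq> V - {a, b}.
    F (insert a (insert b X)) + F Y \<le> F (insert a Z) + F (insert b Z')"
proof -
  have "insert a (insert b X) \<subseteq> V" "Y \<subseteq> V" "a \<in> insert a (insert b X)" "a \<notin> Y"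
    using ab XY by auto
  with ex show ?thesis
  proof (cases rule: exchange_cases)
    case move
    have "insert a (insert b X) - {a} = insert b X"
      using XY ab by auto
    then have "F (insert a (insert b X)) + F Y \<le> F (insert a Y) + F (insert b X)"
      using move by (simp add: add.commute)
    then show ?thesis
      using XY by blast
  next
    case (swap j)
    have "insert j (insert a (insert b X) - {a}) = insert b (insert j X)"
      using XY ab swap by auto
    then have "F (insert a (insert b X)) + F Y \<le> F (insert a (Y - {j})) + F (insert b (insert j X))"
      using swap(3) by (simp add: add.commute)
    moreover have "insert j X \<subseteq> V - {a, b}" "Y - {j} \<subseteq> V - {a, b}"
      using XY swap by auto
    ultimately show ?thesis
      by blast
  qed
qed

lemma finite_max_attained:
  fixes g :: "'b \<Rightarrow> ereal"
  assumes "finite S" "S \<noteq> {}"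
  obtains z where "z \<in> S" "\<And>y. y \<in> S \<Longrightarrow> g y \<le> g z"
proof -
  have "Max (g ` S) \<in> g ` S"
    using assms by (intro Max_in) auto
  then obtain z where "z \<in> S" "Max (g ` S) = g z"
    by blast
  moreover have "g y \<le> Max (g ` S)" if "y \<in> S" for y
    using that assms by auto
  ultimately show ?thesis
    using that by metis
qed

text \<open>
  Induction on \<open>E\<close>, the merge of the two copies of \<open>e\<close> replacing \<open>F\<close>. It has to be shown that the
  hypothesis survives: for any prices on \<open>E\<close> there is a sufficiently good \<open>Z\<close> that contains exactly one
  copy of \<open>e\<close>. Otherwise, by \<open>exchange_midpoint\<close>, the best values over all \<open>Z\<close> without \<open>e\<close> and over
  all \<open>Z\<close> with both copies have a sum below \<open>2 * c\<close>, and a suitable price \<open>t\<close> for \<open>e\<close> pushes both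
  below \<open>c\<close>, against the hypothesis for the prices extended by \<open>t\<close>.
\<close>
lemma exchange_partition:
  fixes c :: real and E :: "'a set"
  assumes "finite E" "exchange (E \<times> UNIV) F"
    and "\<And>p. \<exists>Z \<subseteq> E \<times> UNIV. ereal c \<le> F Z + ereal (excess E p Z)"
  shows "\<exists>J \<subseteq> E. ereal c \<le> F (J \<times> {True} \<union> (E - J) \<times> {False})"
  using assms
proof (induction E arbitrary: F rule: finite_induct)
  case empty
  then show ?case
    by (auto simp: excess_def)
next
  case (insert e E)
  let ?V = "insert e E \<times> (UNIV :: bool set)"
  let ?a = "(e, True)" and ?b = "(e, False)"
  have ab: "?a \<in> ?V" "?b \<in> ?V" "?a \<noteq> ?b"
    by auto
  have V: "?V - {?a, ?b} = E \<times> UNIV"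
    using insert.hyps by auto
  have finV: "finite ?V"
    using insert.hyps by simp
  have "exchange (E \<times> UNIV) (merge ?a ?b F)"
    using exchange_merge[OF insert.prems(1) finV ab] unfolding V .
  moreover have "\<exists>Z \<subseteq> E \<times> UNIV. ereal c \<le> merge ?a ?b F Z + ereal (excess E p Z)" for p
  proof (rule ccontr)
    assume neg: "\<not> ?thesis"
    define G where "G Z = F Z + ereal (excess E p Z)" for Z
    have exG: "exchange ?V G"
      unfolding G_def using insert.prems(1) excess_modular[OF insert.hyps(1)]
      by (rule exchange_add_modular)
    have one: "G (insert ?a Z) < ereal c" "G (insert ?b Z) < ereal c" if Z: "Z \<subseteq> E \<times> UNIV" for Z
    proof -
      have lt: "merge ?a ?b F Z + ereal (excess E p Z) < ereal c"
        using neg Z by (meson not_le)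
      have "F (insert ?a Z) \<le> merge ?a ?b F Z" "F (insert ?b Z) \<le> merge ?a ?b F Z"
        by (auto simp: merge_def)
      from this[THEN add_right_mono, of "ereal (excess E p Z)"] lt
      show "G (insert ?a Z) < ereal c" "G (insert ?b Z) < ereal c"
        unfolding G_def excess_insert_outside[OF insert.hyps(2)] by auto
    qed
    have S: "finite (Pow (E \<times> (UNIV :: bool set)))" "Pow (E \<times> (UNIV :: bool set)) \<noteq> {}"
      using insert.hyps by auto
    obtain Z0 where Z0: "Z0 \<subseteq> E \<times> UNIV" "\<And>Z. Z \<subseteq> E \<times> UNIV \<Longrightarrow> G Z \<le> G Z0"
      using finite_max_attained[OF S, of G] by auto
    obtain Z2 where Z2: "Z2 \<subseteq> E \<times> UNIV"
      "\<And>Z. Z \<subseteq> E \<times> UNIV \<Longrightarrow> G (insert ?a (insert ?b Z)) \<le> G (insert ?a (insert ?b Z2))"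
      using finite_max_attained[OF S, of "\<lambda>Z. G (insert ?a (insert ?b Z))"] by auto
    obtain Z Z' where "Z \<subseteq> E \<times> UNIV" "Z' \<subseteq> E \<times> UNIV"
      "G (insert ?a (insert ?b Z2)) + G Z0 \<le> G (insert ?a Z) + G (insert ?b Z')"
      using exchange_midpoint[OF exG ab, of Z2 Z0] Z0(1) Z2(1) unfolding V by blast
    moreover from this have "G (insert ?a Z) + G (insert ?b Z') < ereal c + ereal c"
      using one by (intro ereal_add_strict_mono2) auto
    ultimately have "G Z0 + G (insert ?a (insert ?b Z2)) < ereal c + ereal c"
      by (simp add: add.commute)
    then obtain t where t: "G Z0 < ereal c + ereal t" "G (insert ?a (insert ?b Z2)) + ereal t < ereal c"
      by (rule ereal_price_between) auto
    obtain Z where Z: "Z \<subseteq> ?V"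
      and Zc: "ereal c \<le> F Z + ereal (excess (insert e E) (p(e := t)) Z)"
      using insert.prems(2) by blast
    define Y where "Y = Z - {?a} - {?b}"
    have Y: "Y \<subseteq> E \<times> UNIV"
      using Z unfolding Y_def by auto
    have "F Z + ereal (excess (insert e E) (p(e := t)) Z) =
        G Z + ereal (t * (of_bool (?a \<in> Z) + of_bool (?b \<in> Z) - 1))"
      unfolding G_def excess_insert_element[OF insert.hyps] by (cases "F Z") auto
    with Zc have Gc: "ereal c \<le> G Z + ereal (t * (of_bool (?a \<in> Z) + of_bool (?b \<in> Z) - 1))"
      by simp
    consider "?a \<in> Z" "?b \<in> Z" | "?a \<in> Z" "?b \<notin> Z" | "?a \<notin> Z" "?b \<in> Z" | "?a \<notin> Z" "?b \<notin> Z"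
      by blast
    then show False
    proof cases
      case 1
      then have "Z = insert ?a (insert ?b Y)"
        unfolding Y_def by auto
      then have "G Z + ereal t \<le> G (insert ?a (insert ?b Z2)) + ereal t"
        using Z2(2)[OF Y] by (simp add: add_right_mono)
      then show False
        using Gc 1 t(2) by auto
    next
      case 2
      then have "Z = insert ?a Y"
        unfolding Y_def by auto
      then show False
        using Gc 2 one(1)[OF Y] by simp
    next
      case 3
      then have "Z = insert ?b Y"
        unfolding Y_def by auto
      then show False
        using Gc 3 one(2)[OF Y] by simp
    next
      case 4
      then have "Z = Y"
        unfolding Y_def by auto
      then have "G Z < ereal c + ereal t"
        using Z0(2)[OF Y] t(1) by simp
      moreover have "ereal c \<le> G Z + ereal (- t)"
        using Gc 4 by simp
      ultimately show False
        by (cases "G Z") auto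
    qed
  qed
  ultimately obtain J where J: "J \<subseteq> E"
    "ereal c \<le> merge ?a ?b F (J \<times> {True} \<union> (E - J) \<times> {False})"
    using insert.IH by blast
  have "insert e J \<times> {True} \<union> (insert e E - insert e J) \<times> {False} =
      insert ?a (J \<times> {True} \<union> (E - J) \<times> {False})"
    "J \<times> {True} \<union> (insert e E - J) \<times> {False} =
      insert ?b (J \<times> {True} \<union> (E - J) \<times> {False})"
    using J(1) insert.hyps by auto
  then have "ereal c \<le> F (insert e J \<times> {True} \<union> (insert e E - insert e J) \<times> {False}) \<or>
      ereal c \<le> F (J \<times> {True} \<union> (insert e E - J) \<times> {False})"
    using J(2) by (auto simp: merge_def le_max_iff_disj)
  then show ?case
    using J(1) by (meson insert_mono subset_insertI2)
qed

section \<open>Moving a set of elements at fixed prices\<close>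

definition best :: "('a set \<Rightarrow> ereal) \<Rightarrow> 'a set \<Rightarrow> 'a set \<Rightarrow> nat \<Rightarrow> ereal" where
  "best F E P s = Max ((\<lambda>A. F (P \<union> A)) ` {A. A \<subseteq> E \<and> card A \<le> s})"

lemma best_ge:
  assumes "finite E" "A \<subseteq> E" "card A \<le> s"
  shows "F (P \<union> A) \<le> best F E P s"
  unfolding best_def using assms by (intro Max_ge) auto

lemma best_attained:
  assumes "finite E"
  obtains A where "A \<subseteq> E" "card A \<le> s" "best F E P s = F (P \<union> A)"
proof -
  have "{} \<in> {A. A \<subseteq> E \<and> card A \<le> s}"
    by simp
  then have "best F E P s \<in> (\<lambda>A. F (P \<union> A)) ` {A. A \<subseteq> E \<and> card A \<le> s}"
    unfolding best_def using assms by (intro Max_in) auto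
  then show ?thesis
    using that by auto
qed

lemma best_move_one:
  assumes ex: "exchange V F" and E: "finite E" "E \<subseteq> V" "P \<inter> E = {}"
    and PQ: "P \<subseteq> V" "Q \<subseteq> P" and i: "i \<in> P" "i \<notin> Q"
  shows "best F E P s + best F E Q t \<le> best F E (P - {i}) (Suc s) + best F E (insert i Q) t"
proof -
  obtain A where A: "A \<subseteq> E" "card A \<le> s" "best F E P s = F (P \<union> A)"
    using best_attained[OF E(1)] .
  obtain B where B: "B \<subseteq> E" "card B \<le> t" "best F E Q t = F (Q \<union> B)"
    using best_attained[OF E(1)] .
  have fin: "finite A" "finite B"
    using A B E finite_subset by blast+
  have "P \<union> A \<subseteq> V" "Q \<union> B \<subseteq> V" "i \<in> P \<union> A" "i \<notin> Q \<union> B"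
    using A B E PQ i by auto
  with ex show ?thesis
  proof (cases rule: exchange_cases)
    case move
    have e: "P \<union> A - {i} = (P - {i}) \<union> A" "insert i (Q \<union> B) = insert i Q \<union> B"
      using A E i by auto
    have "best F E P s + best F E Q t \<le> F ((P - {i}) \<union> A) + F (insert i Q \<union> B)"
      using move unfolding e A(3) B(3) .
    also have "\<dots> \<le> best F E (P - {i}) (Suc s) + best F E (insert i Q) t"
      using A B E by (intro add_mono best_ge) auto
    finally show ?thesis .
  next
    case (swap j)
    then have j: "j \<in> B" "j \<notin> A" "j \<notin> P"
      using PQ by auto
    have e: "insert j (P \<union> A - {i}) = (P - {i}) \<union> insert j A"
      "insert i (Q \<union> B - {j}) = insert i Q \<union> (B - {j})"
      using A E i j PQ by auto
    have "best F E P s + best F E Q t \<le>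
        F ((P - {i}) \<union> insert j A) + F (insert i Q \<union> (B - {j}))"
      using swap(3) unfolding e A(3) B(3) .
    also have "\<dots> \<le> best F E (P - {i}) (Suc s) + best F E (insert i Q) t"
      using A B E j fin card_Diff1_le[of B j]
      by (intro add_mono best_ge) (auto simp: card_insert_if)
    finally show ?thesis .
  qed
qed

lemma best_not_PInf:
  assumes "exchange V F" "finite E" "E \<subseteq> V" "P \<subseteq> V"
  shows "best F E P s \<noteq> \<infinity>"
proof -
  obtain A where "A \<subseteq> E" "best F E P s = F (P \<union> A)"
    using best_attained[OF assms(2)] .
  then show ?thesis
    using exchange_not_PInf[OF assms(1), of "P \<union> A"] assms by auto
qed

text \<open>
  Telescoping of \<open>best_move_one\<close>. That lemma needs the second set to lie inside the first, and so
  moving \<open>i\<close> after \<open>I\<close> requires the smaller set \<open>Q\<close>, not \<open>Q \<union> I\<close>. Hence the single move is combined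
  with the induction hypothesis for \<open>insert i Q\<close>, and the mixed terms cancel.
\<close>
lemma best_move:
  assumes ex: "exchange V F" and E: "finite E" "E \<subseteq> V" "P \<inter> E = {}"
    and P: "P \<subseteq> V" and I: "finite I" "I \<subseteq> P - Q" and Q: "Q \<subseteq> P"
  shows "best F E P s + best F E Q t \<le> best F E (P - I) (s + card I) + best F E (Q \<union> I) t"
  using I Q
proof (induction I arbitrary: Q rule: finite_induct)
  case empty
  then show ?case
    by simp
next
  case (insert i I)
  have np: "best F E R r \<noteq> \<infinity>" if "R \<subseteq> P" for R r
    by (rule best_not_PInf[OF ex E(1,2)]) (use that P in auto)
  have i: "i \<in> P" "i \<notin> Q" "i \<notin> I"
    using insert by auto
  show ?case
  proof (cases "\<bar>best F E P s\<bar> = \<infinity> \<or> \<bar>best F E Q t\<bar> = \<infinity>")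
    case True
    then have "best F E P s + best F E Q t = -\<infinity>"
      using np[of P s] np[of Q t] insert.prems by auto
    then show ?thesis
      by (simp only: ereal_less_eq simp_thms)
  next
    case False
    have "best F E P s + best F E Q t \<le> best F E (P - {i}) (Suc s) + best F E (insert i Q) t"
      using best_move_one[OF ex E P insert.prems(2) i(1,2)] .
    then have d1: "\<bar>best F E (insert i Q) t\<bar> \<noteq> \<infinity>"
      by (rule finite_if_sum_finite(2))
        (use False np[of "P - {i}" "Suc s"] np[of "insert i Q" t] i insert.prems in auto)
    have IH: "best F E P s + best F E (insert i Q) t \<le>
        best F E (insert i Q \<union> I) t + best F E (P - I) (s + card I)"
      using insert.IH[of "insert i Q"] insert.prems i by (auto simp: add.commute)
    then have d2: "\<bar>best F E (P - I) (s + card I)\<bar> \<noteq> \<infinity>"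
      by (rule finite_if_sum_finite(2))
        (use False d1 np[of "P - I" "s + card I"] np[of "insert i Q \<union> I" t] insert.prems in auto)
    have "best F E (P - I) (s + card I) + best F E Q t \<le>
        best F E (P - I - {i}) (Suc (s + card I)) + best F E (insert i Q) t"
      using P E i insert.prems by (intro best_move_one[OF ex]) auto
    moreover have "P - I - {i} = P - insert i I"
      by auto
    ultimately have "best F E Q t + best F E (P - I) (s + card I) \<le>
        best F E (P - insert i I) (s + card (insert i I)) + best F E (insert i Q) t"
      using insert.hyps by (simp add: add.commute)
    from ereal_add_le_cancel[OF IH this d1 d2] show ?thesis
      by (simp add: add.commute)
  qed
qed

section \<open>The multiple exchange property\<close>

theorem theorem2:
  fixes N :: "'a set" and f :: "'a set \<Rightarrow> ereal" and X Y I :: "'a set"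
  assumes "finite N"
    and "M_natural_concave N f"
    and "X \<subseteq> N" and "Y \<subseteq> N"
    and "I \<subseteq> X - Y"
  shows "f X + f Y \<le>
    Max {f ((X - I) \<union> J) + f ((Y - J) \<union> I) | J. J \<subseteq> Y - X \<and> card J \<le> card I}"
proof (cases "\<bar>f X\<bar> = \<infinity> \<or> \<bar>f Y\<bar> = \<infinity>")
  case True
  then have "f X + f Y = -\<infinity>"
    using exchange_not_PInf[OF exchange_if_M_natural_concave[OF assms(2)]] assms by auto
  then show ?thesis
    by (simp only: ereal_less_eq simp_thms)
next
  case False
  note ex = exchange_if_M_natural_concave[OF assms(2)]
  define E where "E = Y - X"
  define C where "C = X \<inter> Y"
  have E: "finite E" "E \<subseteq> N" "X \<inter> E = {}"
    using assms finite_subset[of Y N] unfolding E_def by auto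
  have fI: "finite I"
    using assms by (meson finite_Diff finite_subset)
  obtain c where c: "f X + f Y = ereal c"
    using False by (cases "f X"; cases "f Y") auto
  define f1 where "f1 A = (if card A \<le> card I then f ((X - I) \<union> A) else -\<infinity>)" for A
  define f2 where "f2 B = f ((C \<union> I) \<union> B)" for B
  define F where "F Z = f1 (layer True Z) + f2 (layer False Z)" for Z
  have "exchange E f1"
    unfolding f1_def using assms E
    by (intro exchange_truncate exchange_contract[OF ex]) auto
  moreover have "exchange E f2"
    unfolding f2_def using assms E
    by (intro exchange_contract[OF ex]) (auto simp: C_def E_def)
  ultimately have exF: "exchange (E \<times> UNIV) F"
    unfolding F_def by (rule exchange_direct_sum)
  have "\<exists>Z \<subseteq> E \<times> UNIV. ereal c \<le> F Z + ereal (excess E p Z)" for p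
  proof -
    \<comment> \<open>The prices are absorbed into \<open>f\<close>: \<open>Y\<close> contains \<open>E\<close> and \<open>X\<close> misses it, so \<open>G X + G Y\<close> is \<open>c\<close> plus
      the price of \<open>E\<close>.\<close>
    define G where "G Z = f Z + ereal (sum p (E \<inter> Z))" for Z
    have exG: "exchange N G"
      unfolding G_def using ex sum_Int_modular[OF E(1)] by (rule exchange_add_modular)
    obtain A where A: "A \<subseteq> E" "card A \<le> card I" "best G E (X - I) (card I) = G ((X - I) \<union> A)"
      using best_attained[OF E(1)] .
    obtain B where B: "B \<subseteq> E" "best G E (C \<union> I) (card E) = G ((C \<union> I) \<union> B)"
      using best_attained[OF E(1)] .
    have "G X \<le> best G E X 0"
      using best_ge[OF E(1), of "{}" 0 G X] by simp
    moreover have "G Y \<le> best G E C (card E)"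
    proof -
      have "C \<union> E = Y"
        by (auto simp: C_def E_def)
      then show ?thesis
        using best_ge[OF E(1), of E "card E" G C] by simp
    qed
    ultimately have "G X + G Y \<le> best G E X 0 + best G E C (card E)"
      by (rule add_mono)
    also have "\<dots> \<le> best G E (X - I) (0 + card I) + best G E (C \<union> I) (card E)"
      using assms by (intro best_move[OF exG E _ fI]) (auto simp: C_def)
    finally have le: "G X + G Y \<le> G ((X - I) \<union> A) + G ((C \<union> I) \<union> B)"
      using A B by simp
    have sums: "E \<inter> X = {}" "E \<inter> Y = E" "E \<inter> ((X - I) \<union> A) = A" "E \<inter> ((C \<union> I) \<union> B) = B"
      using A B assms by (auto simp: C_def E_def)
    have le': "ereal c + ereal (sum p E) \<le>
        (f1 A + f2 B) + ereal (sum p A + sum p B)"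
      using le A(2) unfolding G_def sums c[symmetric] f1_def f2_def
      by (simp add: ac_simps flip: plus_ereal.simps(1))
    define Z where "Z = A \<times> {True} \<union> B \<times> {False}"
    have lay: "layer True Z = A" "layer False Z = B"
      by (auto simp: Z_def layer_def)
    have ints: "E \<inter> A = A" "E \<inter> B = B"
      using A B by auto
    have "ereal c \<le> F Z + ereal (excess E p Z)"
      using le' unfolding F_def excess_def lay ints by (cases "f1 A + f2 B") auto
    moreover have "Z \<subseteq> E \<times> UNIV"
      using A B by (auto simp: Z_def)
    ultimately show ?thesis
      by blast
  qed
  from exchange_partition[OF E(1) exF this]
  obtain J where J: "J \<subseteq> E" "ereal c \<le> F (J \<times> {True} \<union> (E - J) \<times> {False})"
    by blast
  have lay: "layer True (J \<times> {True} \<union> (E - J) \<times> {False}) = J"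
    "layer False (J \<times> {True} \<union> (E - J) \<times> {False}) = E - J"
    by (auto simp: layer_def)
  have set: "(C \<union> I) \<union> (E - J) = (Y - J) \<union> I"
    using J(1) by (auto simp: C_def E_def)
  have "f2 (E - J) \<noteq> \<infinity>"
    unfolding f2_def set using exchange_not_PInf[OF ex, of "(Y - J) \<union> I"] assms by blast
  with J(2) have "card J \<le> card I"
    unfolding F_def lay f1_def by (cases "f2 (E - J)") (auto split: if_splits)
  with J(2) have "f X + f Y \<le> f ((X - I) \<union> J) + f ((Y - J) \<union> I)"
    unfolding F_def lay f1_def f2_def set c by simp
  moreover have "finite {f ((X - I) \<union> J) + f ((Y - J) \<union> I) | J. J \<subseteq> Y - X \<and> card J \<le> card I}"
    using E(1) unfolding E_def by simp
  then have "f ((X - I) \<union> J) + f ((Y - J) \<union> I) \<le>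
      Max {f ((X - I) \<union> J) + f ((Y - J) \<union> I) | J. J \<subseteq> Y - X \<and> card J \<le> card I}"
    using J(1) \<open>card J \<le> card I\<close> unfolding E_def by (intro Max_ge) blast+
  ultimately show ?thesis
    by (rule order_trans)
qed

end
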